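(* Let $B_2$ be the graph on vertex set $\{0,1,\ldots,17\}$ with edges $(0,1),(0,2),(0,14),(1,5),(1,11),(2,3),(2,6),(3,4),(3,9),(4,5),(4,7),(5,6),(6,8),(7,8),(7,17),(8,9),(9,15),(10,11),(10,14),(10,16),(11,12),(12,13),(12,17),(13,14),(13,15),(15,16),(16,17)$ (the second Blanuša snark). Then $23 \le \pi(B_2) \le 29$.
   Context: A pebble distribution on a graph $G=(V,E)$ is a function $C:V\to\mathbb{Z}_{\ge 0}$, with size $|C|=\sum_v C(v)$. A pebbling move removes two pebbles from a vertex $u$ and places one pebble on a neighbour $v$ of $u$. A distribution $C$ is $r$-solvable if some sequence of pebbling moves ends with at least one pebble on $r$. The pebbling number $\pi(G,r)$ is the smallest integer $t$ such that every distribution of size $t$ is $r$-solvable, and $\pi(G)=\max_{r\in V}\pi(G,r)$. *)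

theory Defs
  imports Main
begin

text \<open>A graph is given by its vertex set \<open>V\<close> and its set \<open>E\<close> of undirected edges, each edge being
  the two-element set of its ends.\<close>

definition simple_graph :: "'a set \<Rightarrow> 'a set set \<Rightarrow> bool" where
  "simple_graph V E \<longleftrightarrow> finite V \<and> (\<forall>e\<in>E. e \<subseteq> V \<and> card e = 2)"

text \<open>A function on \<open>V\<close> is represented by a total function that is 0 outside \<open>V\<close>.\<close>

definition distributions :: "'a set \<Rightarrow> ('a \<Rightarrow> nat) set" where
  "distributions V = {C. \<forall>v. v \<notin> V \<longrightarrow> C v = 0}"

definition dist_size :: "'a set \<Rightarrow> ('a \<Rightarrow> nat) \<Rightarrow> nat" where
  "dist_size V C = (\<Sum>v\<in>V. C v)"

inductive pebbling_move :: "'a set set \<Rightarrow> ('a \<Rightarrow> nat) \<Rightarrow> ('a \<Rightarrow> nat) \<Rightarrow> bool" for E where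
  "{u, v} \<in> E \<Longrightarrow> u \<noteq> v \<Longrightarrow> 2 \<le> C u \<Longrightarrow> pebbling_move E C (C(u := C u - 2, v := C v + 1))"

definition solvable :: "'a set set \<Rightarrow> 'a \<Rightarrow> ('a \<Rightarrow> nat) \<Rightarrow> bool" where
  "solvable E r C \<longleftrightarrow> (\<exists>C'. (pebbling_move E)\<^sup>*\<^sup>* C C' \<and> 1 \<le> C' r)"

text \<open>The least element below is meaningful for connected graphs only: otherwise no \<open>t\<close> qualifies.\<close>

definition rooted_pebbling_number :: "'a set \<Rightarrow> 'a set set \<Rightarrow> 'a \<Rightarrow> nat" where
  "rooted_pebbling_number V E r =
     (LEAST t. \<forall>C\<in>distributions V. dist_size V C = t \<longrightarrow> solvable E r C)"

definition pebbling_number :: "'a set \<Rightarrow> 'a set set \<Rightarrow> nat" where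
  "pebbling_number V E = Max (rooted_pebbling_number V E ` V)"

definition blanusa2_verts :: "nat set" where
  "blanusa2_verts = {0..17}"

definition blanusa2_edges :: "nat set set" where
  "blanusa2_edges =
    {{0,1}, {0,2}, {0,14}, {1,5}, {1,11}, {2,3}, {2,6}, {3,4}, {3,9},
     {4,5}, {4,7}, {5,6}, {6,8}, {7,8}, {7,17}, {8,9}, {9,15}, {10,11},
     {10,14}, {10,16}, {11,12}, {12,13}, {12,17}, {13,14}, {13,15}, {15,16}, {16,17}}"

lemma simple_graph_blanusa2: "simple_graph blanusa2_verts blanusa2_edges"
  by (simp add: simple_graph_def blanusa2_verts_def blanusa2_edges_def)

end

theory Submission imports Defs begin

text \<open>Upper bound: on a tree rooted at \<open>r\<close> whose weights at least double from child to parent,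
  moving pebbles towards the root never loses weight, so a distribution of more than the total weight
  of the tree is \<open>r\<close>-solvable. For each \<open>r\<close> there are three such trees whose weights
  sum to at least \<open>K\<close> on every vertex other than \<open>r\<close> and to less than \<open>29 K\<close> altogether, so that
  29 pebbles outweigh one of the trees.

  Lower bound: counting the moves along each arc, a solution yields a nonnegative integral flow in
  which twice the outflow of every vertex is at most its pebbles plus its inflow, and at the root one
  pebble is left over. For a suitable distribution of 22 pebbles no such flow exists, by
  branch and bound with linear programming duality at the leaves.\<close>

section \<open>Weight functions\<close>

lemma solvable_of_moves:
  assumes "(pebbling_move E)\<^sup>*\<^sup>* C C'" "solvable E r C'"
  shows "solvable E r C"
  using assms unfolding solvable_def by (meson rtranclp_trans)

lemma pebbling_move_iterate:
  assumes "{u, v} \<in> E" "u \<noteq> v" "2 * k \<le> C u"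
  shows "(pebbling_move E)\<^sup>*\<^sup>* C (C(u := C u - 2 * k, v := C v + k))"
  using assms(3)
proof (induction k)
  case (Suc k)
  let ?D = "C(u := C u - 2 * k, v := C v + k)"
  have "pebbling_move E ?D (?D(u := ?D u - 2, v := ?D v + 1))"
    using assms Suc.prems by (intro pebbling_move.intros) auto
  moreover have "?D(u := ?D u - 2, v := ?D v + 1) = C(u := C u - 2 * Suc k, v := C v + Suc k)"
    using assms(2) by auto
  ultimately have "pebbling_move E ?D (C(u := C u - 2 * Suc k, v := C v + Suc k))" by (simp only:)
  moreover have "(pebbling_move E)\<^sup>*\<^sup>* C ?D" using Suc by (simp del: fun_upd_apply)
  ultimately show ?case by (rule rtranclp.rtrancl_into_rtrancl[rotated])
qed simp

text \<open>Entries are (vertex, parent, weight), with every vertex listed before its parent.\<close>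

fun strategy :: "'a set set \<Rightarrow> 'a \<Rightarrow> ('a \<times> 'a \<times> nat) list \<Rightarrow> bool" where
  "strategy E r [] \<longleftrightarrow> True"
| "strategy E r ((v, p, w) # ts) \<longleftrightarrow>
     {v, p} \<in> E \<and> v \<noteq> p \<and> v \<noteq> r \<and> v \<notin> fst ` set ts \<and>
     (p = r \<or> (\<exists>(u, q, w') \<in> set ts. u = p \<and> 2 * w \<le> w')) \<and> strategy E r ts"

definition total_weight :: "('a \<times> 'a \<times> nat) list \<Rightarrow> nat" where
  "total_weight ts = (\<Sum>(v, p, w)\<leftarrow>ts. w)"

definition weight_of :: "('a \<times> 'a \<times> nat) list \<Rightarrow> ('a \<Rightarrow> nat) \<Rightarrow> nat" where
  "weight_of ts C = (\<Sum>(v, p, w)\<leftarrow>ts. w * C v)"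

lemma weight_of_mono:
  assumes "\<And>v. v \<in> fst ` set ts \<Longrightarrow> C v \<le> C' v"
  shows "weight_of ts C \<le> weight_of ts C'"
  unfolding weight_of_def using assms by (force intro: sum_list_mono)

lemma weight_of_increase:
  assumes "(p, q, w) \<in> set ts" "C' p = C p + k" "\<And>v. v \<in> fst ` set ts \<Longrightarrow> C v \<le> C' v"
  shows "weight_of ts C + w * k \<le> weight_of ts C'"
proof -
  obtain xs ys where ts: "ts = xs @ (p, q, w) # ys" using assms(1) by (meson split_list)
  have "weight_of xs C \<le> weight_of xs C'" "weight_of ys C \<le> weight_of ys C'"
    using assms(3) ts by (auto intro!: weight_of_mono)
  then show ?thesis using assms(2) by (simp add: ts weight_of_def algebra_simps)
qed

text \<open>The head of the list is a leaf of the remaining tree. Moving \<open>C v div 2\<close>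
  pebbles from it to its parent either puts a pebble on the root or lowers the weight by at most
  \<open>w\<close>. The total weight drops by exactly \<open>w\<close>, so the induction hypothesis
  applies to the tail.\<close>

lemma weight_function_lemma:
  assumes "strategy E r ts" "total_weight ts < weight_of ts C"
  shows "solvable E r C"
  using assms
proof (induction ts arbitrary: C)
  case Nil
  then show ?case by (simp add: weight_of_def)
next
  case (Cons a ts)
  obtain v p w where a: "a = (v, p, w)" by (cases a)
  define k where "k = C v div 2"
  define D where "D = C(v := C v - 2 * k, p := C p + k)"
  have moves: "(pebbling_move E)\<^sup>*\<^sup>* C D"
    unfolding D_def k_def using Cons.prems a by (intro pebbling_move_iterate) auto
  show ?case
  proof (cases "p = r \<and> 0 < k")
    case True
    then have "solvable E r D" unfolding solvable_def D_def by auto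
    then show ?thesis by (rule solvable_of_moves[OF moves])
  next
    case False
    have le: "C u \<le> D u" if "u \<in> fst ` set ts" for u
      using that Cons.prems a by (auto simp: D_def)
    have "weight_of ts C + 2 * w * k \<le> weight_of ts D"
    \<comment> \<open>If \<open>k = 0\<close>, the parent may be the root, which has no entry;
      otherwise the parent is listed with weight at least \<open>2 * w\<close>.\<close>
    proof (cases "k = 0")
      case True
      then show ?thesis using weight_of_mono[OF le] by simp
    next
      case False
      then obtain q w' where "(p, q, w') \<in> set ts" "2 * w \<le> w'"
        using \<open>\<not> (p = r \<and> 0 < k)\<close> Cons.prems a by auto
      moreover have "D p = C p + k" using Cons.prems a by (simp add: D_def)
      ultimately have "weight_of ts C + w' * k \<le> weight_of ts D" using le by (intro weight_of_increase)
      with mult_le_mono1[OF \<open>2 * w \<le> w'\<close>, of k] show ?thesis by linarith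
    qed
    \<comment> \<open>At most one pebble stays behind at \<open>v\<close>; its weight
      \<open>w\<close> is paid for by removing the entry from the total.\<close>
    moreover have "w * C v \<le> w * (2 * k + 1)" unfolding k_def by (intro mult_le_mono2) linarith
    ultimately have "total_weight ts < weight_of ts D"
      using Cons.prems(2) a by (simp add: total_weight_def weight_of_def algebra_simps)
    then have "solvable E r D" using Cons a by simp
    then show ?thesis by (rule solvable_of_moves[OF moves])
  qed
qed

section \<open>Combining several trees\<close>

lemma weight_of_concat: "weight_of (concat Ts) C = (\<Sum>ts\<leftarrow>Ts. weight_of ts C)"
  by (induction Ts) (simp_all add: weight_of_def)

lemma total_weight_concat: "total_weight (concat Ts) = (\<Sum>ts\<leftarrow>Ts. total_weight ts)"
  by (induction Ts) (simp_all add: total_weight_def)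

text \<open>The weight is linear in \<open>C\<close>, so its coefficient at \<open>v\<close> is its
  value at a single pebble on \<open>v\<close>. In this form the covering condition can be
  evaluated.\<close>

lemma weight_of_eq_sum:
  assumes "finite V" "fst ` set ts \<subseteq> V"
  shows "weight_of ts C = (\<Sum>v\<in>V. weight_of ts (\<lambda>u. of_bool (u = v)) * C v)"
  using assms(2)
proof (induction ts)
  case Nil
  then show ?case by (simp add: weight_of_def)
next
  case (Cons a ts)
  obtain v p w where a: "a = (v, p, w)" by (cases a)
  have "w * C v = (\<Sum>u\<in>V. w * of_bool (v = u) * C u)"
    using Cons.prems assms(1) a by (simp add: of_bool_def if_distrib if_distribR cong: if_cong)
  then show ?case using Cons a by (simp add: weight_of_def sum.distrib algebra_simps)
qed

text \<open>Averaging: an unsolvable distribution outweighs none of the trees, so summing over the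
  trees bounds \<open>K * n\<close> by the sum of their totals.\<close>

lemma strategies_solvable:
  assumes "simple_graph V E" and C: "C \<in> distributions V" "dist_size V C = n"
    and strategies: "\<And>ts. ts \<in> set Ts \<Longrightarrow> strategy E r ts"
    and cover: "\<And>v. v \<in> V \<Longrightarrow> v \<noteq> r \<Longrightarrow> K \<le> weight_of (concat Ts) (\<lambda>u. of_bool (u = v))"
    and total: "total_weight (concat Ts) < K * n"
  shows "solvable E r C"
proof (rule ccontr)
  assume unsolvable: "\<not> solvable E r C"
  \<comment> \<open>An empty root makes both sides of the covering estimate vanish at
    \<open>r\<close>, the one vertex that \<open>cover\<close> leaves out.\<close>
  then have "C r = 0" unfolding solvable_def by force
  have vertices: "fst ` set ts \<subseteq> V" if "strategy E r ts" for ts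
  proof -
    have "{v, p} \<in> E \<Longrightarrow> v \<in> V" for v p using assms(1) by (auto simp: simple_graph_def)
    with that show ?thesis
    proof (induction ts)
      case (Cons a ts)
      then show ?case by (cases a) (simp, blast)
    qed simp
  qed
  have "K * n = (\<Sum>v\<in>V. K * C v)"
    using C by (simp add: dist_size_def flip: sum_distrib_left)
  also have "\<dots> \<le> (\<Sum>v\<in>V. weight_of (concat Ts) (\<lambda>u. of_bool (u = v)) * C v)"
    using cover \<open>C r = 0\<close> by (intro sum_mono) (metis mult_0_right mult_le_mono1 order_refl)
  also have "\<dots> = weight_of (concat Ts) C"
  proof (rule weight_of_eq_sum[symmetric])
    show "finite V" using assms(1) by (simp add: simple_graph_def)
    show "fst ` set (concat Ts) \<subseteq> V" using vertices[OF strategies] by (simp add: image_UN UN_subset_iff)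
  qed
  also have "\<dots> \<le> total_weight (concat Ts)"
    unfolding weight_of_concat total_weight_concat
  proof (rule sum_list_mono)
    fix ts assume "ts \<in> set Ts"
    then show "weight_of ts C \<le> total_weight ts"
      using weight_function_lemma[OF strategies] unsolvable not_le by blast
  qed
  finally show False using total by simp
qed

section \<open>Pebbling flows\<close>

text \<open>Arcs leaving the root are excluded: a solution may stop as soon as it reaches the root.\<close>

definition arcs :: "'a set set \<Rightarrow> 'a \<Rightarrow> ('a \<times> 'a) set" where
  "arcs E r = {(u, v). {u, v} \<in> E \<and> u \<noteq> v \<and> u \<noteq> r}"

lemma sum_increment:
  fixes x :: "'a \<Rightarrow> nat"
  assumes "finite S"
  shows "(\<Sum>a\<in>S. (x(b := x b + 1)) a) = (\<Sum>a\<in>S. x a) + of_bool (b \<in> S)"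
  using assms by (induction S rule: finite_induct) auto

text \<open>Here \<open>x a\<close> counts the moves along \<open>a\<close> until the root first
  holds a pebble. Conservation at each vertex is an equation; discarding the pebbles that remain,
  except one at the root, gives the inequality.\<close>

lemma solvable_imp_flow:
  assumes "finite (arcs E r)" "solvable E r C"
  obtains x :: "'a \<times> 'a \<Rightarrow> nat" where
    "\<And>v. 2 * (\<Sum>a | a \<in> arcs E r \<and> fst a = v. x a) + of_bool (v = r)
          \<le> C v + (\<Sum>a | a \<in> arcs E r \<and> snd a = v. x a)"
proof -
  define flow where "flow D x \<longleftrightarrow>
    (\<forall>v. D v + 2 * (\<Sum>a | a \<in> arcs E r \<and> fst a = v. x a) = C v + (\<Sum>a | a \<in> arcs E r \<and> snd a = v. x a))"
    for D and x :: "'a \<times> 'a \<Rightarrow> nat"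
  \<comment> \<open>In the first disjunct \<open>D\<close> is bound afresh: it freezes a moment at
    which the root held a pebble. Until then the second disjunct follows the current
    distribution.\<close>
  have "(\<exists>D x. flow D x \<and> 1 \<le> D r) \<or> (\<exists>x. flow D x)" if "(pebbling_move E)\<^sup>*\<^sup>* C D" for D
    using that
  proof (induction rule: rtranclp_induct)
    case base
    have "flow C (\<lambda>_. 0)" by (simp add: flow_def)
    then show ?case by blast
  next
    case (step D D')
    show ?case
    proof (cases "\<exists>D x. flow D x \<and> 1 \<le> D r")
      case False
      then obtain x where x: "flow D x" "D r = 0" using step.IH by force
      from step.hyps(2) obtain u v where uv: "{u, v} \<in> E" "u \<noteq> v" "2 \<le> D u"
        and D': "D' = D(u := D u - 2, v := D v + 1)" by (auto elim: pebbling_move.cases)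
      \<comment> \<open>The root is empty, so it cannot be the source of this move.\<close>
      then have a: "(u, v) \<in> arcs E r" using x by (auto simp: arcs_def)
      have "flow D' (x((u, v) := x (u, v) + 1))"
        unfolding flow_def
      proof
        fix z
        have "D z + 2 * (\<Sum>a | a \<in> arcs E r \<and> fst a = z. x a)
            = C z + (\<Sum>a | a \<in> arcs E r \<and> snd a = z. x a)" using x by (simp add: flow_def)
        moreover have "D' z + 2 * of_bool (u = z) = D z + of_bool (v = z)"
          using uv D' by auto
        ultimately show "D' z + 2 * (\<Sum>a | a \<in> arcs E r \<and> fst a = z. (x((u, v) := x (u, v) + 1)) a)
            = C z + (\<Sum>a | a \<in> arcs E r \<and> snd a = z. (x((u, v) := x (u, v) + 1)) a)"
          using a assms(1) by (subst (1 2) sum_increment) auto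
      qed
      then show ?thesis by blast
    qed blast
  qed
  then obtain D x where "flow D x" "1 \<le> D r" using assms(2) unfolding solvable_def by blast
  then have "2 * (\<Sum>a | a \<in> arcs E r \<and> fst a = v. x a) + of_bool (v = r)
      \<le> C v + (\<Sum>a | a \<in> arcs E r \<and> snd a = v. x a)" for v
    by (cases "v = r") (auto simp: flow_def dest!: spec[of _ v])
  then show thesis using that by blast
qed


section \<open>Branch-and-bound certificates\<close>

text \<open>\<open>Split P k\<close> branches on whether the flow through the arcs satisfying \<open>P\<close> is at most \<open>k\<close> or at
  least \<open>k + 1\<close>. A leaf holds Farkas multipliers: \<open>\<pi>\<close> for the vertex inequalities and \<open>\<mu>\<close> for
  the branching constraints, most recent first; missing trailing entries of \<open>\<mu>\<close> count as 0. The
  triple \<open>(s, P, b)\<close> encodes the constraint that \<open>s\<close> times the flow through \<open>P\<close> is at most \<open>b\<close>.\<close>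

datatype refutation =
  Potential "int list" "int list"
| Split "nat \<times> nat \<Rightarrow> bool" int refutation refutation

fun refutes :: "(nat \<times> nat) list \<Rightarrow> nat \<Rightarrow> nat list \<Rightarrow> (int \<times> (nat \<times> nat \<Rightarrow> bool) \<times> int) list
    \<Rightarrow> refutation \<Rightarrow> bool" where
  "refutes as r cs bs (Potential \<pi> \<mu>) \<longleftrightarrow>
     length \<pi> = length cs \<and> list_all (\<lambda>p. 0 \<le> p) \<pi> \<and> list_all (\<lambda>m. 0 \<le> m) \<mu> \<and>
     list_all (\<lambda>(u, v). \<pi> ! v \<le> 2 * \<pi> ! u + (\<Sum>(m, s, P, b)\<leftarrow>zip \<mu> bs. m * s * of_bool (P (u, v)))) as \<and>
     (\<Sum>(p, c)\<leftarrow>zip \<pi> cs. p * int c) + (\<Sum>(m, s, P, b)\<leftarrow>zip \<mu> bs. m * b) < \<pi> ! r"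
| "refutes as r cs bs (Split P k R R') \<longleftrightarrow>
     refutes as r cs ((1, P, k) # bs) R \<and> refutes as r cs ((-1, P, - (k + 1)) # bs) R'"

text \<open>Weak duality at a leaf: add the vertex inequalities weighted by \<open>\<pi>\<close> and
  the branching constraints weighted by \<open>\<mu>\<close>. The arc condition cancels the flow
  terms and leaves \<open>\<pi> ! r\<close> bounded by the constant side, against the last leaf
  condition.\<close>

lemma refutes_sound:
  fixes x :: "nat \<times> nat \<Rightarrow> nat"
  assumes "refutes as r cs bs R" "distinct as" "r < length cs"
    and arcs: "fst ` set as \<subseteq> {..<length cs}" "snd ` set as \<subseteq> {..<length cs}"
    and "\<And>s P b. (s, P, b) \<in> set bs \<Longrightarrow> s * (\<Sum>a\<in>set as. of_bool (P a) * int (x a)) \<le> b"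
    and flow: "\<And>v. v < length cs \<Longrightarrow> 2 * (\<Sum>a | a \<in> set as \<and> fst a = v. x a) + of_bool (v = r)
          \<le> cs ! v + (\<Sum>a | a \<in> set as \<and> snd a = v. x a)"
  shows False
  using assms(1,6)
proof (induction R arbitrary: bs)
  case (Potential \<pi> \<mu>)
  let ?n = "length cs"
  have "length \<pi> = ?n" using Potential by simp
  have \<pi>: "0 \<le> \<pi> ! v" if "v < ?n" for v
    using Potential(1) that by (auto simp: list_all_length)
  \<comment> \<open>Sums over vertices become sums over arcs; \<open>f\<close> will be the tail map
    \<open>fst\<close> or the head map \<open>snd\<close>.\<close>
  have regroup: "(\<Sum>v<?n. \<pi> ! v * (\<Sum>a | a \<in> set as \<and> f a = v. int (x a))) = (\<Sum>a\<in>set as. \<pi> ! f a * int (x a))"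
    if "f ` set as \<subseteq> {..<?n}" for f
  proof -
    have "(\<Sum>v<?n. \<pi> ! v * (\<Sum>a | a \<in> set as \<and> f a = v. int (x a)))
        = (\<Sum>v<?n. \<Sum>a | a \<in> set as \<and> f a = v. \<pi> ! f a * int (x a))"
      by (auto simp: sum_distrib_left intro!: sum.cong)
    also have "\<dots> = (\<Sum>a\<in>set as. \<pi> ! f a * int (x a))" using that by (intro sum.group) auto
    finally show ?thesis .
  qed
  \<comment> \<open>Stated for an arbitrary list \<open>L\<close>, so that the induction does not
    have to follow \<open>zip\<close>.\<close>
  have combine: "(\<Sum>a\<in>set as. (\<Sum>(m, s, P, b)\<leftarrow>L. m * s * of_bool (P a)) * int (x a)) \<le> (\<Sum>(m, s, P, b)\<leftarrow>L. m * b)"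
    if "\<And>m s P b. (m, s, P, b) \<in> set L \<Longrightarrow> 0 \<le> m \<and> s * (\<Sum>a\<in>set as. of_bool (P a) * int (x a)) \<le> b" for L
    using that
  proof (induction L)
    case (Cons z L)
    obtain m s P b where z: "z = (m, s, P, b)" by (cases z)
    have "m * (s * (\<Sum>a\<in>set as. of_bool (P a) * int (x a))) \<le> m * b"
      using Cons.prems z by (intro mult_left_mono) auto
    moreover have "(\<Sum>a\<in>set as. (m * s * g a + h a) * int (x a)) = m * (s * (\<Sum>a\<in>set as. g a * int (x a))) + (\<Sum>a\<in>set as. h a * int (x a))" for g h
      by (simp add: sum.distrib sum_distrib_left algebra_simps)
    moreover have "(\<Sum>a\<in>set as. (\<Sum>(m, s, P, b)\<leftarrow>L. m * s * of_bool (P a)) * int (x a)) \<le> (\<Sum>(m, s, P, b)\<leftarrow>L. m * b)"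
      using Cons.prems by (intro Cons.IH) auto
    ultimately show ?case using z by (simp del: sum_of_bool_mult_eq)
  qed simp
  have branch: "(\<Sum>a\<in>set as. (\<Sum>(m, s, P, b)\<leftarrow>zip \<mu> bs. m * s * of_bool (P a)) * int (x a))
      \<le> (\<Sum>(m, s, P, b)\<leftarrow>zip \<mu> bs. m * b)"
    using Potential by (intro combine) (auto simp: list_all_iff dest: set_zip_leftD set_zip_rightD)
  have "\<pi> ! r + 2 * (\<Sum>a\<in>set as. \<pi> ! fst a * int (x a))
      = (\<Sum>v<?n. \<pi> ! v * (2 * (\<Sum>a | a \<in> set as \<and> fst a = v. int (x a)) + of_bool (v = r)))"
    using assms(3) unfolding regroup[OF arcs(1), symmetric]
    by (simp add: sum.distrib distrib_left sum_distrib_left mult.left_commute)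
  also have "\<dots> \<le> (\<Sum>v<?n. \<pi> ! v * (int (cs ! v) + (\<Sum>a | a \<in> set as \<and> snd a = v. int (x a))))"
  proof (intro sum_mono mult_left_mono)
    fix v assume "v \<in> {..<?n}"
    then show "2 * (\<Sum>a | a \<in> set as \<and> fst a = v. int (x a)) + of_bool (v = r)
        \<le> int (cs ! v) + (\<Sum>a | a \<in> set as \<and> snd a = v. int (x a))"
      using flow[of v] by (simp flip: of_nat_sum add: of_bool_def split: if_splits)
  qed (use \<pi> in auto)
  also have "\<dots> = (\<Sum>(p, c)\<leftarrow>zip \<pi> cs. p * int c) + (\<Sum>a\<in>set as. \<pi> ! snd a * int (x a))"
    using \<open>length \<pi> = ?n\<close>
    by (simp add: regroup[OF arcs(2), symmetric] sum.distrib distrib_left sum_list_sum_nth atLeast0LessThan)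
  also have "(\<Sum>a\<in>set as. \<pi> ! snd a * int (x a))
      \<le> (\<Sum>a\<in>set as. (2 * \<pi> ! fst a + (\<Sum>(m, s, P, b)\<leftarrow>zip \<mu> bs. m * s * of_bool (P a))) * int (x a))"
    using Potential(1) by (intro sum_mono mult_right_mono) (auto simp: list_all_iff)
  also have "\<dots> = 2 * (\<Sum>a\<in>set as. \<pi> ! fst a * int (x a))
      + (\<Sum>a\<in>set as. (\<Sum>(m, s, P, b)\<leftarrow>zip \<mu> bs. m * s * of_bool (P a)) * int (x a))"
    by (simp add: sum.distrib sum_distrib_left algebra_simps)
  finally show False using branch Potential(1) by simp
next
  case (Split P k R R')
  show False
  proof (cases "(\<Sum>a\<in>set as. of_bool (P a) * int (x a)) \<le> k")
    case True
    then show False using Split.prems by (intro Split.IH(1)) auto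
  next
    \<comment> \<open>The flow is integral, so exceeding \<open>k\<close> means being at least
      \<open>k + 1\<close>.\<close>
    case False
    then show False using Split.prems by (intro Split.IH(2)) auto
  qed
qed

lemma arcs_of_list:
  assumes "E = (\<lambda>(u, v). {u, v}) ` set es" "list_all (\<lambda>(u, v). u \<noteq> v) es"
  shows "arcs E r = set (filter (\<lambda>a. fst a \<noteq> r) (es @ map prod.swap es))"
  using assms unfolding arcs_def by (force simp: list_all_iff doubleton_eq_iff image_iff)

section \<open>The second Blanusa snark\<close>

definition blanusa2_edge_list :: "(nat \<times> nat) list" where
  "blanusa2_edge_list =
    [(0, 1), (0, 2), (0, 14), (1, 5), (1, 11), (2, 3), (2, 6), (3, 4), (3, 9), (4, 5), (4, 7), (5, 6), (6, 8), (7, 8), (7, 17), (8, 9), (9, 15), (10, 11), (10, 14), (10, 16), (11, 12), (12, 13), (12, 17), (13, 14), (13, 15), (15, 16), (16, 17)]"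

lemma blanusa2_edges_eq: "blanusa2_edges = (\<lambda>(u, v). {u, v}) ` set blanusa2_edge_list"
  by (simp add: blanusa2_edges_def blanusa2_edge_list_def)

text \<open>The root will be 6. Vertex 10 lies at distance 4 from it and holds 15 pebbles, one short
  of the 2^4 that would suffice alone; seven further vertices hold one pebble each.\<close>

definition stuck_pebbles :: "nat list" where
  "stuck_pebbles = [0, 0, 0, 1, 1, 0, 0, 0, 0, 0, 15, 0, 1, 1, 0, 1, 1, 1]"

text \<open>A bound 0 asks whether an arc or vertex is used at all. The bound 7 on the moves out of
  10 is what its 15 pebbles allow; an eighth move forces a pebble to enter 10.\<close>

definition stuck_refutation :: refutation where
  "stuck_refutation =
  Split (\<lambda>a. a = (8, 6)) 0
    (Split (\<lambda>a. a = (4, 5)) 0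
      (Split (\<lambda>a. fst a = 9) 0
        (Split (\<lambda>a. a = (3, 2)) 0
          (Split (\<lambda>a. fst a = 10) 7
            (Split (\<lambda>a. fst a = 15) 0
              (Split (\<lambda>a. fst a = 13) 0
                (Potential [64, 64, 128, 1, 2, 128, 256, 4, 2, 0, 0, 32, 16, 0, 32, 0, 4, 8] [32, 4, 32, 126, 2, 124, 252])
                (Potential [32, 32, 64, 1, 2, 64, 128, 4, 2, 0, 0, 16, 16, 32, 16, 0, 4, 8] [48, 32, 16, 62, 2, 60, 124]))
              (Split (\<lambda>a. fst a = 12) 0
                (Potential [64, 64, 128, 1, 2, 128, 256, 4, 2, 0, 0, 32, 0, 16, 32, 32, 16, 8] [32, 48, 32, 126, 32, 124, 252])
                (Split (\<lambda>a. fst a = 17) 0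
                  (Potential [2, 2, 4, 0, 0, 4, 8, 0, 0, 0, 0, 1, 2, 1, 1, 2, 1, 0] [2, 3, 3, 1, 4, 2, 4, 8])
                  (Potential [16, 16, 32, 1, 2, 32, 64, 4, 2, 0, 0, 8, 4, 4, 8, 8, 4, 8] [12, 0, 12, 8, 30, 8, 28, 60]))))
            (Split (\<lambda>a. fst a = 15) 0
              (Split (\<lambda>a. fst a = 13) 0
                (Split (\<lambda>a. fst a = 17) 0
                  (Potential [4, 4, 8, 0, 0, 8, 16, 0, 0, 0, 4, 2, 1, 0, 2, 0, 2, 0] [2, 2, 2, 6, 8, 0, 8, 16])
                  (Potential [8, 8, 16, 1, 2, 16, 32, 4, 2, 0, 8, 4, 4, 0, 4, 0, 4, 8] [12, 4, 4, 12, 14, 2, 12, 28]))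
                (Potential [32, 32, 64, 1, 2, 64, 128, 4, 2, 0, 32, 16, 16, 32, 16, 0, 16, 8] [48, 32, 48, 62, 2, 60, 124]))
              (Split (\<lambda>a. fst a = 12) 0
                (Potential [32, 32, 64, 1, 2, 64, 128, 4, 2, 0, 32, 16, 0, 16, 16, 32, 16, 8] [16, 48, 48, 62, 32, 60, 124])
                (Potential [16, 16, 32, 1, 2, 32, 64, 4, 2, 0, 16, 8, 16, 8, 8, 16, 8, 8] [24, 24, 24, 30, 16, 28, 60]))))
          (Split (\<lambda>a. a = (2, 3)) 0
            (Split (\<lambda>a. fst a = 15) 0
              (Split (\<lambda>a. a = (5, 4)) 0
                (Split (\<lambda>a. fst a = 13) 0
                  (Potential [4, 4, 8, 32, 16, 8, 16, 8, 8, 16, 1, 2, 2, 0, 2, 0, 2, 4] [2, 0, 16, 16, 56])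
                  (Potential [4, 4, 8, 32, 16, 8, 16, 8, 8, 16, 1, 2, 2, 4, 2, 0, 2, 4] [6, 0, 16, 16, 56]))
                (Potential [8, 8, 16, 8, 4, 16, 32, 2, 4, 4, 2, 4, 2, 2, 4, 0, 1, 1] [28, 4, 0, 0, 0, 8, 24]))
              (Potential [4, 4, 8, 32, 16, 8, 16, 8, 8, 2, 1, 2, 2, 2, 2, 4, 2, 4] [6, 16, 56, 28]))
            (Potential [8, 8, 16, 8, 4, 16, 32, 2, 1, 0, 2, 4, 2, 2, 4, 1, 1, 1] [24, 0, 8, 8, 30])))
        (Split (\<lambda>a. fst a = 17) 0
          (Split (\<lambda>a. fst a = 4) 0
            (Split (\<lambda>a. fst a = 10) 7
              (Potential [4, 4, 8, 4, 0, 8, 16, 2, 4, 8, 0, 2, 1, 2, 2, 4, 2, 0] [2, 4, 2, 12, 4, 8])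
              (Potential [4, 4, 8, 4, 0, 8, 16, 2, 4, 8, 4, 2, 1, 2, 2, 4, 2, 0] [6, 8, 2, 12, 0, 8]))
            (Potential [4, 4, 8, 4, 8, 8, 16, 4, 4, 8, 1, 2, 1, 2, 2, 4, 2, 0] [12, 4, 12, 4, 8]))
          (Split (\<lambda>a. fst a = 4) 0
            (Potential [4, 4, 8, 4, 0, 8, 16, 2, 4, 8, 1, 2, 2, 2, 2, 4, 2, 4] [4, 6, 12, 4, 8])
            (Potential [4, 4, 8, 4, 8, 8, 16, 4, 4, 8, 1, 2, 2, 2, 2, 4, 2, 4] [12, 4, 12, 4, 8]))))
      (Split (\<lambda>a. a = (7, 4)) 0
        (Split (\<lambda>a. a = (5, 4)) 0
          (Split (\<lambda>a. fst a = 10) 7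
            (Split (\<lambda>a. a = (2, 3)) 0
              (Split (\<lambda>a. snd a = 1) 0
                (Split (\<lambda>a. fst a = 13) 0
                  (Potential [8, 8, 16, 32, 64, 16, 32, 4, 8, 16, 0, 2, 1, 0, 4, 8, 4, 2] [8, 4, 0, 4, 32, 56, 112, 16])
                  (Potential [4, 4, 8, 16, 32, 8, 16, 2, 4, 8, 0, 2, 2, 4, 2, 4, 2, 1] [4, 0, 0, 2, 16, 28, 56, 8]))
                (Split (\<lambda>a. fst a = 8) 0
                  (Split (\<lambda>a. a = (17, 16)) 0
                    (Potential [8, 8, 16, 32, 64, 16, 32, 2, 4, 16, 0, 4, 2, 4, 4, 8, 4, 1] [2, 8, 0, 0, 4, 32, 60, 112, 16])
                    (Potential [2, 2, 4, 8, 16, 4, 8, 4, 4, 4, 0, 1, 1, 1, 1, 2, 1, 2] [3, 0, 0, 0, 1, 8, 8, 28]))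
                  (Potential [2, 2, 4, 8, 16, 4, 8, 4, 8, 4, 0, 1, 1, 1, 1, 2, 1, 2] [12, 0, 0, 1, 8, 8, 28, 4])))
              (Potential [8, 8, 16, 8, 16, 16, 32, 2, 4, 4, 0, 4, 2, 2, 4, 2, 1, 1] [24, 4, 0, 12, 16, 24]))
            (Potential [4, 4, 8, 16, 32, 8, 16, 2, 4, 8, 4, 2, 1, 2, 2, 4, 2, 1] [6, 16, 28, 56, 8]))
          (Potential [8, 8, 16, 8, 8, 16, 32, 2, 4, 4, 2, 4, 2, 2, 4, 2, 1, 1] [24, 4, 0, 24]))
        (Split (\<lambda>a. fst a = 3) 0
          (Split (\<lambda>a. fst a = 15) 0
            (Split (\<lambda>a. fst a = 10) 7
              (Potential [4, 4, 8, 0, 4, 8, 16, 8, 4, 2, 0, 2, 2, 1, 2, 0, 2, 4] [2, 2, 8, 12, 0, 8])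
              (Potential [4, 4, 8, 0, 4, 8, 16, 8, 4, 2, 4, 2, 2, 1, 2, 0, 2, 4] [6, 2, 8, 12, 0, 8]))
            (Potential [4, 4, 8, 0, 4, 8, 16, 8, 4, 2, 1, 2, 2, 2, 2, 4, 2, 4] [6, 8, 12, 0, 8]))
          (Potential [4, 4, 8, 16, 8, 8, 16, 8, 8, 8, 1, 2, 2, 2, 2, 4, 2, 4] [24, 8, 8]))))
    (Split (\<lambda>a. fst a = 3) 0
      (Split (\<lambda>a. fst a = 13) 0
        (Potential [2, 4, 1, 0, 16, 8, 2, 32, 64, 32, 4, 4, 8, 0, 2, 16, 8, 16] [16, 32, 126])
        (Potential [2, 2, 1, 0, 8, 4, 2, 16, 32, 16, 2, 2, 4, 8, 4, 8, 4, 8] [8, 16, 62]))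
      (Potential [4, 2, 8, 16, 8, 4, 8, 8, 16, 8, 1, 1, 2, 2, 2, 4, 2, 4] [24, 24]))"

lemma stuck: "refutes (filter (\<lambda>a. fst a \<noteq> 6) (blanusa2_edge_list @ map prod.swap blanusa2_edge_list))
    6 stuck_pebbles [] stuck_refutation"
  by code_simp

section \<open>Strategies up to symmetry\<close>

text \<open>The automorphism group has six orbits on the vertices; each entry of \<open>blanusa2_strategies\<close> is
  (orbit representative \<open>r\<close>, covering constant \<open>K\<close>, strategies for \<open>r\<close>).\<close>

definition blanusa2_automorphisms :: "nat list list" where
  "blanusa2_automorphisms =
   [[0, 1, 2, 3, 4, 5, 6, 7, 8, 9, 10, 11, 12, 13, 14, 15, 16, 17],
    [0, 1, 14, 13, 12, 11, 10, 17, 16, 15, 6, 5, 4, 3, 2, 9, 8, 7],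
    [1, 0, 5, 4, 3, 2, 6, 9, 8, 7, 10, 14, 13, 12, 11, 17, 16, 15],
    [1, 0, 11, 12, 13, 14, 10, 15, 16, 17, 6, 2, 3, 4, 5, 7, 8, 9]]"

definition blanusa2_strategies :: "(nat \<times> nat \<times> (nat \<times> nat \<times> nat) list list) list" where
  "blanusa2_strategies =
   [(0, 4,
     [[(7, 4, 1), (17, 12, 1), (4, 5, 2), (12, 11, 2), (5, 1, 4), (11, 1, 4), (1, 0, 8)],
      [(17, 7, 1), (7, 8, 2), (4, 3, 2), (8, 6, 4), (9, 3, 2), (3, 2, 4), (6, 2, 8), (2, 0, 16)],
      [(7, 17, 1), (9, 15, 2), (17, 12, 2), (12, 13, 4), (15, 13, 4), (16, 10, 4), (10, 14, 8), (13, 14, 8), (14, 0, 16)]]),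
    (2, 16,
     [[(17, 16, 6), (11, 10, 12), (12, 13, 11), (15, 13, 8), (16, 10, 12), (10, 14, 24), (13, 14, 22), (1, 0, 8), (14, 0, 48), (0, 2, 96)],
      [(12, 17, 3), (16, 15, 2), (17, 7, 6), (7, 4, 12), (15, 9, 4), (4, 3, 24), (9, 3, 8), (3, 2, 48)],
      [(12, 11, 2), (16, 15, 2), (11, 1, 4), (15, 9, 4), (17, 7, 4), (1, 5, 8), (7, 8, 8), (9, 8, 8), (5, 6, 16), (8, 6, 16), (6, 2, 32)]]),
    (3, 4,
     [[(10, 14, 1), (11, 1, 1), (1, 0, 2), (14, 0, 2), (0, 2, 4), (2, 3, 8)],
      [(10, 11, 1), (11, 1, 2), (12, 17, 2), (1, 5, 4), (6, 5, 4), (8, 7, 4), (17, 7, 4), (5, 4, 8), (7, 4, 8), (4, 3, 16)],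
      [(11, 10, 1), (10, 16, 2), (12, 13, 2), (14, 13, 2), (13, 15, 4), (16, 15, 4), (15, 9, 8), (9, 3, 16)]]),
    (6, 12,
     [[(11, 10, 1), (12, 13, 2), (16, 10, 2), (10, 14, 4), (13, 14, 4), (14, 0, 8), (0, 2, 16), (2, 6, 32)],
      [(16, 10, 2), (10, 11, 4), (12, 11, 4), (11, 1, 8), (1, 5, 16), (5, 6, 32)],
      [(10, 16, 4), (11, 12, 3), (14, 13, 4), (12, 17, 6), (13, 15, 8), (16, 15, 8), (3, 9, 12), (4, 7, 12), (15, 9, 16), (17, 7, 12), (7, 8, 24), (9, 8, 32), (8, 6, 64)]]),
    (7, 6,
     [[(14, 0, 1), (0, 1, 2), (2, 6, 2), (11, 1, 2), (1, 5, 4), (6, 5, 4), (3, 4, 2), (5, 4, 8), (4, 7, 16)],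
      [(14, 13, 1), (0, 2, 2), (13, 15, 2), (2, 6, 4), (3, 9, 4), (15, 9, 4), (6, 8, 8), (9, 8, 8), (8, 7, 16)],
      [(0, 14, 2), (1, 11, 2), (14, 10, 4), (10, 16, 8), (11, 12, 4), (13, 12, 4), (15, 16, 2), (12, 17, 8), (16, 17, 16), (17, 7, 32)]]),
    (8, 4,
     [[(10, 14, 1), (11, 1, 2), (14, 0, 2), (0, 2, 4), (1, 5, 4), (3, 2, 4), (4, 5, 4), (2, 6, 8), (5, 6, 8), (6, 8, 16)],
      [(14, 10, 1), (10, 16, 2), (11, 12, 2), (13, 12, 2), (12, 17, 4), (16, 17, 4), (17, 7, 8), (7, 8, 16)],
      [(10, 16, 1), (14, 13, 1), (13, 15, 2), (16, 15, 2), (15, 9, 4), (9, 8, 8)]])]"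

definition map_vertices :: "nat list \<Rightarrow> (nat \<times> nat \<times> nat) list list \<Rightarrow> (nat \<times> nat \<times> nat) list list" where
  "map_vertices \<sigma> = map (map (\<lambda>(v, p, w). (\<sigma> ! v, \<sigma> ! p, w)))"

definition covering :: "nat \<Rightarrow> nat \<Rightarrow> (nat \<times> nat \<times> nat) list list \<Rightarrow> bool" where
  "covering r K Ts \<longleftrightarrow> list_all (strategy blanusa2_edges r) Ts \<and>
     list_all (\<lambda>v. v = r \<or> K \<le> weight_of (concat Ts) (\<lambda>u. of_bool (u = v))) [0..<18] \<and>
     total_weight (concat Ts) < K * 29"

text \<open>Every transported family of trees is checked by evaluation, in place of a proof that the
  four lists are automorphisms and that these preserve strategies.\<close>

lemma blanusa2_strategies_covering:
  "list_all (\<lambda>(r, K, Ts). list_all (\<lambda>\<sigma>. covering (\<sigma> ! r) K (map_vertices \<sigma> Ts)) blanusa2_automorphisms)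
     blanusa2_strategies"
  by code_simp

lemma blanusa2_orbits:
  "list_all (\<lambda>r. \<exists>(q, _) \<in> set blanusa2_strategies. \<exists>\<sigma> \<in> set blanusa2_automorphisms. r = \<sigma> ! q) [0..<18]"
  by code_simp

section \<open>The two bounds\<close>

lemma blanusa2_solvable:
  assumes "r \<in> blanusa2_verts" "C \<in> distributions blanusa2_verts" "dist_size blanusa2_verts C = 29"
  shows "solvable blanusa2_edges r C"
proof -
  have verts: "v \<in> blanusa2_verts \<longleftrightarrow> v \<in> set [0..<18]" for v by (auto simp: blanusa2_verts_def)
  obtain q K Ts \<sigma> where "(q, K, Ts) \<in> set blanusa2_strategies" "\<sigma> \<in> set blanusa2_automorphisms" "r = \<sigma> ! q"
    using blanusa2_orbits assms(1) unfolding verts list_all_iff by fast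
  then have "covering r K (map_vertices \<sigma> Ts)"
    using blanusa2_strategies_covering by (auto simp: list_all_iff)
  then show ?thesis
    using assms verts unfolding covering_def list_all_iff
    by (intro strategies_solvable[OF simple_graph_blanusa2, of C 29 "map_vertices \<sigma> Ts" r K]) auto
qed

text \<open>The flow conditions are inequalities in the pebbles, so one refutation serves all
  distributions below \<open>stuck_pebbles\<close>, and hence all sizes up to 22.\<close>

lemma stuck_unsolvable:
  assumes "\<And>v. v < length stuck_pebbles \<Longrightarrow> C v \<le> stuck_pebbles ! v"
  shows "\<not> solvable blanusa2_edges 6 C"
proof
  let ?as = "filter (\<lambda>a. fst a \<noteq> 6) (blanusa2_edge_list @ map prod.swap blanusa2_edge_list)"
  have as: "arcs blanusa2_edges 6 = set ?as"
    by (rule arcs_of_list[OF blanusa2_edges_eq]) (simp add: blanusa2_edge_list_def)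
  assume "solvable blanusa2_edges 6 C"
  then obtain x :: "nat \<times> nat \<Rightarrow> nat" where x:
    "2 * (\<Sum>a | a \<in> set ?as \<and> fst a = v. x a) + of_bool (v = 6)
      \<le> C v + (\<Sum>a | a \<in> set ?as \<and> snd a = v. x a)" for v
    using solvable_imp_flow[of blanusa2_edges 6 C] unfolding as by blast
  show False
  proof (rule refutes_sound[OF stuck, of x])
    show "2 * (\<Sum>a | a \<in> set ?as \<and> fst a = v. x a) + of_bool (v = 6)
        \<le> stuck_pebbles ! v + (\<Sum>a | a \<in> set ?as \<and> snd a = v. x a)"
      if "v < length stuck_pebbles" for v
      using x[of v] assms[OF that] by linarith
  qed (auto simp: blanusa2_edge_list_def stuck_pebbles_def)
qed

text \<open>Greedy choice: take \<open>min t (f a)\<close> at each element and pass on the rest.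
  This cuts the stuck distribution down to any prescribed smaller size.\<close>

lemma exists_smaller_function_of_sum:
  fixes f :: "'a \<Rightarrow> nat"
  assumes "finite V" "t \<le> sum f V"
  shows "\<exists>g. (\<forall>v. g v \<le> f v) \<and> sum g V = t"
  using assms
proof (induction V arbitrary: t rule: finite_induct)
  case (insert a V)
  then have "t - min t (f a) \<le> sum f V" by simp
  then obtain g where g: "\<forall>v. g v \<le> f v" "sum g V = t - min t (f a)"
    using insert.IH by blast
  have "sum (g(a := min t (f a))) V = sum g V" using insert.hyps by (intro sum.cong) auto
  then have "sum (g(a := min t (f a))) (insert a V) = min t (f a) + sum g V"
    using insert.hyps by simp
  then show ?case using g by (intro exI[of _ "g(a := min t (f a))"]) auto
qed auto

theorem theorem2:
  "23 \<le> pebbling_number blanusa2_verts blanusa2_edges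
   \<and> pebbling_number blanusa2_verts blanusa2_edges \<le> 29"
proof -
  let ?V = blanusa2_verts and ?E = blanusa2_edges
  let ?P = "\<lambda>r t. \<forall>C\<in>distributions ?V. dist_size ?V C = t \<longrightarrow> solvable ?E r C"
  have V: "finite ?V" "6 \<in> ?V" by (auto simp: blanusa2_verts_def)
  have upper: "rooted_pebbling_number ?V ?E r \<le> 29" if "r \<in> ?V" for r
    unfolding rooted_pebbling_number_def using blanusa2_solvable[OF that] by (intro Least_le) blast
  \<comment> \<open>A least size below 23 is refuted by a part of \<open>stuck_pebbles\<close> of
    exactly that size, so no monotonicity of solvability in \<open>t\<close> enters.\<close>
  have "23 \<le> rooted_pebbling_number ?V ?E 6"
  proof (rule ccontr)
    let ?t = "rooted_pebbling_number ?V ?E 6"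
    assume "\<not> 23 \<le> ?t"
    define f where "f v = (if v < 18 then stuck_pebbles ! v else 0)" for v
    have "sum f ?V = 22"
      by (simp add: f_def blanusa2_verts_def stuck_pebbles_def sum.atLeast_Suc_atMost numeral_eq_Suc)
    then obtain g where g: "\<forall>v. g v \<le> f v" "sum g ?V = ?t"
      using exists_smaller_function_of_sum[OF V(1), of ?t f] \<open>\<not> 23 \<le> ?t\<close> by auto
    have "g v = 0" if "v \<notin> ?V" for v
      using g(1) that by (auto simp: f_def blanusa2_verts_def dest: spec[of _ v])
    then have "g \<in> distributions ?V" by (simp add: distributions_def)
    moreover have "?P 6 ?t"
      unfolding rooted_pebbling_number_def
      \<comment> \<open>The least size has the property only if some size has it; the upper bound
        supplies 29.\<close>
      by (rule LeastI[where P = "?P 6" and k = 29]) (use blanusa2_solvable V in blast)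
    ultimately have "solvable ?E 6 g" using g(2) by (simp add: dist_size_def)
    moreover have "g v \<le> stuck_pebbles ! v" if "v < length stuck_pebbles" for v
      using g(1)[rule_format, of v] that by (simp add: f_def stuck_pebbles_def split: if_splits)
    ultimately show False using stuck_unsolvable by blast
  qed
  also have "\<dots> \<le> pebbling_number ?V ?E"
    unfolding pebbling_number_def using V by (intro Max_ge) auto
  finally show ?thesis
    unfolding pebbling_number_def using upper V by (auto intro!: Max.boundedI)
qed

end
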